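(* Let $R$ be a circular order on a set $X$ and $\emptyset\neq A\subseteq X$. There exist a canonically defined circularly ordered set $X_A=(\operatorname{Split}(X;A),R_A)$ and an onto map $q:X_A\to X$ (those described in the context) such that the following conditions are satisfied, where $X$ and $X_A$ carry their interval topologies: (i) $q:X_A\to X$ is circular order preserving (COP), the preimage $q^{-1}(a)$ of any $a\in A$ consists of exactly two points, while $q^{-1}(x)$ is a singleton for every $x\in X\setminus A$. Moreover, $(X_A,\lambda_{R_A})$, as a topological space, is a LOTS. (ii) $q:X_A\to X$ is a continuous closed (hence quotient) map with fibers of at most two points. In particular, $q$ is a perfect map. (iii) If $X$ is compact (respectively, locally compact) then $X_A$ is compact (respectively, locally compact). (iv) If $X$ is separable and $A$ is countable, then $X_A$ is separable. (v) If $X$ is second countable and $A$ is countable, then $X_A$ is second countable. (vi) If $X$ is metrizable and $A$ is countable, then $X_A$ is metrizable.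
   Context: A circular order on a set $X$ is a ternary relation $R\subseteq X^3$ (write $[a,b,c]$ for $(a,b,c)\in R$) satisfying: cyclicity ($[a,b,c]\Rightarrow[b,c,a]$); asymmetry ($[a,b,c]\Rightarrow (c,b,a)\notin R$); transitivity ($[a,b,c]$ and $[a,c,d]$ imply $[a,b,d]$); totality (if $a,b,c$ are distinct then $[a,b,c]$ or $[a,c,b]$). Put $(a,b)_R:=\{x\in X:[a,x,b]\}$ and $[a,b]_R:=(a,b)_R\cup\{a,b\}$. The interval topology $\lambda_R$ is the topology on $X$ with base $\{X\setminus[a,b]_R: a,b\in X\}\cup\{X\}$. A map $f:X_1\to X_2$ of circularly ordered sets is COP if: (COP1) whenever $[a,b,c]$ in $X_1$ and $f(a),f(b),f(c)$ are pairwise distinct, then $[f(a),f(b),f(c)]$ in $X_2$; (COP2) if $f(x)=f(y)$ then $f$ is constant on one of the closed intervals $[x,y]$, $[y,x]$. A topological space is a LOTS if its topology is the interval topology (generated by the open rays) of some linear order on it. The split space: as a set, $X_A:=\{a^-,a^+:a\in A\}\cup(X\setminus A)$ (each $a\in A$ is replaced by two distinct points $a^-,a^+$), and $q:X_A\to X$ is $q(a^{\pm})=a$ for $a\in A$, $q(x)=x$ for $x\in X\setminus A$. The circular order $R_A$ consists of: all triples $(u,w,v)\in X_A^3$ with $[q(u),q(w),q(v)]$ in $R$; and, for every $a\in A$ and every $u\in X_A\setminus\{a^+,a^-\}$, the triples $[a^-,u,a^+]$, $[u,a^+,a^-]$, $[a^+,a^-,u]$. *)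

theory Defs
  imports "HOL-Analysis.Analysis"
begin

definition circular_order_on :: "'a set \<Rightarrow> ('a \<times> 'a \<times> 'a) set \<Rightarrow> bool" where
  "circular_order_on X R \<longleftrightarrow>
     R \<subseteq> X \<times> X \<times> X \<and>
     (\<forall>a b c. (a, b, c) \<in> R \<longrightarrow> (b, c, a) \<in> R) \<and>
     (\<forall>a b c. (a, b, c) \<in> R \<longrightarrow> (c, b, a) \<notin> R) \<and>
     (\<forall>a b c d. (a, b, c) \<in> R \<and> (a, c, d) \<in> R \<longrightarrow> (a, b, d) \<in> R) \<and>
     (\<forall>a\<in>X. \<forall>b\<in>X. \<forall>c\<in>X. a \<noteq> b \<and> b \<noteq> c \<and> a \<noteq> c \<longrightarrow> (a, b, c) \<in> R \<or> (a, c, b) \<in> R)"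

definition circ_open_interval :: "'a set \<Rightarrow> ('a \<times> 'a \<times> 'a) set \<Rightarrow> 'a \<Rightarrow> 'a \<Rightarrow> 'a set" where
  "circ_open_interval X R a b = {x \<in> X. (a, x, b) \<in> R}"

definition circ_closed_interval :: "'a set \<Rightarrow> ('a \<times> 'a \<times> 'a) set \<Rightarrow> 'a \<Rightarrow> 'a \<Rightarrow> 'a set" where
  "circ_closed_interval X R a b = circ_open_interval X R a b \<union> {a, b}"

definition circ_base :: "'a set \<Rightarrow> ('a \<times> 'a \<times> 'a) set \<Rightarrow> 'a set set" where
  "circ_base X R = {X - circ_closed_interval X R a b | a b. a \<in> X \<and> b \<in> X} \<union> {X}"

definition circ_topology :: "'a set \<Rightarrow> ('a \<times> 'a \<times> 'a) set \<Rightarrow> 'a topology" where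
  "circ_topology X R = topology_generated_by (circ_base X R)"

text \<open>For a circular order, the generating family really is a base: see
  \<open>openin_circ_topology\<close> and \<open>topspace_circ_topology\<close>.\<close>

lemma topspace_circ_topology: "topspace (circ_topology X R) = X"
  unfolding circ_topology_def topology_generated_by_topspace
  by (auto simp: circ_base_def)

lemma circ_base_Int:
  assumes R: "circular_order_on X R"
    and U: "U \<in> circ_base X R" and V: "V \<in> circ_base X R" and p: "p \<in> U \<inter> V"
  shows "\<exists>W \<in> circ_base X R. p \<in> W \<and> W \<subseteq> U \<inter> V"
proof (cases "U = X \<or> V = X")
  case True
  then show ?thesis
    using U V p by (auto simp: circ_base_def)
next
  case False
  obtain a b c d where ab: "U = X - circ_closed_interval X R a b" "a \<in> X" "b \<in> X"
    and cd: "V = X - circ_closed_interval X R c d" "c \<in> X" "d \<in> X"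
    using U V False by (auto simp: circ_base_def)
  have pX: "p \<in> X" using p ab by auto
  note R' = R[unfolded circular_order_on_def]
  have cyc: "(x, y, z) \<in> R \<Longrightarrow> (y, z, x) \<in> R" for x y z
    using R'[THEN conjunct2, THEN conjunct1] by metis
  have asym: "(x, y, z) \<in> R \<Longrightarrow> (z, y, x) \<notin> R" for x y z
    using R'[THEN conjunct2, THEN conjunct2, THEN conjunct1] by metis
  have tr: "(x, y, z) \<in> R \<Longrightarrow> (x, z, w) \<in> R \<Longrightarrow> (x, y, w) \<in> R" for x y z w
    using R'[THEN conjunct2, THEN conjunct2, THEN conjunct2, THEN conjunct1] by metis
  have tot: "(x, y, z) \<in> R \<or> (x, z, y) \<in> R"
    if "x \<in> X" "y \<in> X" "z \<in> X" "x \<noteq> y" "y \<noteq> z" "x \<noteq> z" for x y z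
    using R'[THEN conjunct2, THEN conjunct2, THEN conjunct2, THEN conjunct2] that by metis
  have inX: "(x, y, z) \<in> R \<Longrightarrow> y \<in> X" for x y z
    using R'[THEN conjunct1] by auto
  define le where "le x y \<longleftrightarrow> x = y \<or> (p, x, y) \<in> R" for x y
  have le_tr: "le x z" if "le x y" "le y z" for x y z
    using that tr[of p x y z] unfolding le_def by auto
  have le_tot: "le x y \<or> le y x" if "x \<in> X" "y \<in> X" "x \<noteq> p" "y \<noteq> p" for x y
    using that tot[of p x y] pX unfolding le_def by auto
  have le_end: "le x y" if "x \<in> X" "y \<in> X" "p \<notin> circ_closed_interval X R x y" for x y
    using that tot[of p x y] cyc[of p y x] cyc[of y x p] pX
    unfolding le_def circ_closed_interval_def circ_open_interval_def by auto
  have mem: "z \<in> circ_closed_interval X R x y \<longleftrightarrow> le x z \<and> le z y \<and> z \<noteq> p"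
    if xy: "le x y" "x \<in> X" "y \<in> X" "x \<noteq> p" "y \<noteq> p" for x y z
  proof -
    have iff: "z \<in> circ_closed_interval X R x y \<longleftrightarrow> z = x \<or> z = y \<or> (x, z, y) \<in> R"
      using inX[of x z y] by (auto simp: circ_closed_interval_def circ_open_interval_def)
    have fw: "le x z \<and> le z y \<and> z \<noteq> p" if z: "(x, z, y) \<in> R"
    proof -
      have ne: "x \<noteq> y" using z asym[OF z] by auto
      then have pxy: "(p, x, y) \<in> R" using xy by (auto simp: le_def)
      have xyp: "(x, y, p) \<in> R" and ypx: "(y, p, x) \<in> R"
        using cyc[OF pxy] cyc[OF cyc[OF pxy]] by auto
      have yxz: "(y, x, z) \<in> R" using cyc[OF cyc[OF z]] .
      have "(x, z, p) \<in> R" using tr[OF z xyp] .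
      then have 1: "(p, x, z) \<in> R" using cyc[of x z p] cyc[of z p x] by auto
      have "(y, p, z) \<in> R" using tr[OF ypx yxz] .
      then have 2: "(p, z, y) \<in> R" using cyc[of y p z] by auto
      have "z \<noteq> p" using 1 asym[OF 1] cyc[OF 1] asym[OF cyc[OF 1]] by auto
      then show ?thesis using 1 2 by (auto simp: le_def)
    qed
    have bw: "z = x \<or> z = y \<or> (x, z, y) \<in> R" if z: "le x z" "le z y"
    proof (cases "z = x \<or> z = y")
      case False
      then have xz: "(p, x, z) \<in> R" and zy: "(p, z, y) \<in> R" using z by (auto simp: le_def)
      have "(z, y, x) \<in> R" using tr[OF cyc[OF zy] cyc[OF cyc[OF xz]]] .
      then show ?thesis using cyc[of z y x] cyc[of y x z] by auto
    qed auto
    show ?thesis using iff fw bw xy by (auto simp: le_def)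
  qed
  have nep: "a \<noteq> p" "b \<noteq> p" "c \<noteq> p" "d \<noteq> p"
    using p ab cd by (auto simp: circ_closed_interval_def)
  have leab: "le a b" and lecd: "le c d"
    using le_end[of a b] le_end[of c d] ab cd p by auto
  obtain e where e: "e \<in> {a, c}" "le e a" "le e c"
    using le_tot[of a c] nep ab cd by (auto simp: le_def)
  obtain f where f: "f \<in> {b, d}" "le b f" "le d f"
    using le_tot[of b d] nep ab cd by (auto simp: le_def)
  have ef: "e \<in> X" "f \<in> X" "e \<noteq> p" "f \<noteq> p" using e f nep ab cd by auto
  have leef: "le e f" using le_tr[OF le_tr[OF e(2) leab] f(2)] .
  have "X - circ_closed_interval X R e f \<in> circ_base X R"
    using ef by (auto simp: circ_base_def)
  moreover have "circ_closed_interval X R a b \<subseteq> circ_closed_interval X R e f"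
    using le_tr[OF e(2)] le_tr[OF _ f(2)] leab leef nep ab ef by (auto simp: mem)
  moreover have "circ_closed_interval X R c d \<subseteq> circ_closed_interval X R e f"
    using le_tr[OF e(3)] le_tr[OF _ f(3)] lecd leef nep cd ef by (auto simp: mem)
  moreover have "p \<notin> circ_closed_interval X R e f"
    using leef ef by (simp add: mem)
  ultimately show ?thesis using pX ab cd
    by (intro bexI[of _ "X - circ_closed_interval X R e f"]) auto
qed

lemma openin_circ_topology:
  assumes "circular_order_on X R"
  shows "openin (circ_topology X R) = arbitrary union_of (\<lambda>U. U \<in> circ_base X R)"
proof
  fix U
  show "openin (circ_topology X R) U = (arbitrary union_of (\<lambda>U. U \<in> circ_base X R)) U"
  proof
    assume "openin (circ_topology X R) U"
    then have "generate_topology_on (circ_base X R) U"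
      by (simp add: circ_topology_def openin_topology_generated_by_iff)
    then show "(arbitrary union_of (\<lambda>U. U \<in> circ_base X R)) U"
    proof induction
      case Empty
      then show ?case by simp
    next
      case (Int A B)
      show ?case
        unfolding arbitrary_union_of_alt
      proof
        fix p assume p: "p \<in> A \<inter> B"
        obtain U V where "U \<in> circ_base X R" "p \<in> U" "U \<subseteq> A" "V \<in> circ_base X R" "p \<in> V" "V \<subseteq> B"
          using Int.IH p unfolding arbitrary_union_of_alt by blast
        then show "\<exists>W. W \<in> circ_base X R \<and> p \<in> W \<and> W \<subseteq> A \<inter> B"
          using circ_base_Int[OF assms, of U V p] by blast
      qed
    next
      case (UN K)
      then show ?case by (intro arbitrary_union_of_Union) auto
    next
      case (Basis s)
      then show ?case by (intro arbitrary_union_of_inc)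
    qed
  next
    assume "(arbitrary union_of (\<lambda>U. U \<in> circ_base X R)) U"
    then obtain \<U> where "\<U> \<subseteq> circ_base X R" "U = \<Union>\<U>"
      by (auto simp: union_of_def)
    then show "openin (circ_topology X R) U"
      unfolding circ_topology_def
      using openin_Union topology_generated_by_Basis by (metis subsetD)
  qed
qed

definition COP ::
    "'a set \<Rightarrow> ('a \<times> 'a \<times> 'a) set \<Rightarrow> 'b set \<Rightarrow> ('b \<times> 'b \<times> 'b) set \<Rightarrow> ('a \<Rightarrow> 'b) \<Rightarrow> bool" where
  "COP X1 R1 X2 R2 f \<longleftrightarrow>
     f \<in> X1 \<rightarrow> X2 \<and>
     (\<forall>a b c. (a, b, c) \<in> R1 \<and> f a \<noteq> f b \<and> f b \<noteq> f c \<and> f a \<noteq> f c \<longrightarrow> (f a, f b, f c) \<in> R2) \<and>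
     (\<forall>x\<in>X1. \<forall>y\<in>X1. f x = f y \<longrightarrow>
        f constant_on circ_closed_interval X1 R1 x y \<or> f constant_on circ_closed_interval X1 R1 y x)"

text \<open>\<open>(x, y) \<in> r\<close> stands for \<open>x \<le> y\<close>. The whole space is added to the open rays
  because a one-point linear order has no ray covering its point.\<close>

definition linear_order_topology :: "'a set \<Rightarrow> ('a \<times> 'a) set \<Rightarrow> 'a topology" where
  "linear_order_topology X r = topology_generated_by
     ({{x \<in> X. (x, a) \<in> r \<and> x \<noteq> a} | a. a \<in> X} \<union>
      {{x \<in> X. (a, x) \<in> r \<and> x \<noteq> a} | a. a \<in> X} \<union> {X})"

definition LOTS :: "'a topology \<Rightarrow> bool" where
  "LOTS T \<longleftrightarrow> (\<exists>r. linear_order_on (topspace T) r \<and> T = linear_order_topology (topspace T) r)"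

text \<open>\<open>Minus a\<close> and \<open>Plus a\<close> are the two copies $a^-$ and $a^+$ of a point \<open>a \<in> A\<close>;
  \<open>Keep x\<close> is a point \<open>x\<close> outside \<open>A\<close>.\<close>

datatype 'a split_point = Minus 'a | Plus 'a | Keep 'a

definition Split :: "'a set \<Rightarrow> 'a set \<Rightarrow> 'a split_point set" where
  "Split X A = Minus ` A \<union> Plus ` A \<union> Keep ` (X - A)"

primrec split_proj :: "'a split_point \<Rightarrow> 'a" where
  "split_proj (Minus a) = a"
| "split_proj (Plus a) = a"
| "split_proj (Keep x) = x"

text \<open>In this orientation $a^+$ is immediately followed by $a^-$, i.e. the open interval from
  $a^+$ to $a^-$ is empty, while the one from $a^-$ to $a^+$ contains all other points.\<close>

definition split_order :: "'a set \<Rightarrow> ('a \<times> 'a \<times> 'a) set \<Rightarrow> 'a set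
    \<Rightarrow> ('a split_point \<times> 'a split_point \<times> 'a split_point) set" where
  "split_order X R A =
     {(u, w, v). u \<in> Split X A \<and> w \<in> Split X A \<and> v \<in> Split X A \<and>
        (split_proj u, split_proj w, split_proj v) \<in> R} \<union>
     (\<Union>a\<in>A. \<Union>u \<in> Split X A - {Plus a, Minus a}.
        {(Minus a, u, Plus a), (u, Plus a, Minus a), (Plus a, Minus a, u)})"

end

(* Cutting X_A between a^+ and a^- for some a in A turns it into a linear order with endpoints whose
   topology is the circular one. A neighbourhood of a fibre contains the preimage of an open arc, so q
   is perfect. The other claims hold for every perfect map from a Hausdorff space with finite fibres
   and only countably many points in non-singleton fibres. *)

theory Submission
  imports Defs
begin

section \<open>Maps with countably many points in nontrivial fibres\<close>

text \<open>Countability of the nontrivial fibres matters: splitting every point of a circle gives a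
  compact space that is not metrizable. Points of one fibre look alike from \<open>X\<close>, so
  each must be put into the dense set, or be given its own open set or real function; countably many
  such additions are harmless.

  The hard step is closedness of \<open>split_proj\<close>. The arc removed around
  \<open>Minus x\<close> may end at the other twin \<open>Plus x\<close>; the neighbourhood then
  controls only one side of \<open>x\<close>, and the neighbourhoods of both twins must be joined.
  Moreover, arcs need not descend: the closed arc from \<open>Minus b\<close> to
  \<open>Plus b\<close> is the whole split space, whereas both its ends project to \<open>b\<close>
  and the arc from \<open>b\<close> to \<open>b\<close> is one point.\<close>

lemma separable_space_closed_map_preimage:
  assumes X: "separable_space X" and q: "closed_map Y X q" "q ` topspace Y = topspace X"
    and N: "countable N" "N \<subseteq> topspace Y"
      "\<And>y z. \<lbrakk>y \<in> topspace Y; z \<in> topspace Y; q y = q z; y \<noteq> z\<rbrakk> \<Longrightarrow> y \<in> N"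
  shows "separable_space Y"
proof -
  obtain D where D: "countable D" "D \<subseteq> topspace X" "X closure_of D = topspace X"
    using X by (auto simp: separable_space_def)
  define s where "s = inv_into (topspace Y) q"
  have s: "s d \<in> topspace Y" "q (s d) = d" if "d \<in> topspace X" for d
    using that q(2) unfolding s_def by (auto intro: inv_into_into f_inv_into_f)
  have "Y closure_of (N \<union> s ` D) = topspace Y"
    unfolding dense_intersects_open
  proof (intro allI impI)
    fix U assume U: "openin Y U \<and> U \<noteq> {}"
    then obtain y where y: "y \<in> U" by auto
    then have yY: "y \<in> topspace Y" using U openin_subset by blast
    show "(N \<union> s ` D) \<inter> U \<noteq> {}"
    \<comment> \<open>A point outside \<open>N\<close> is its whole fibre, so closedness puts the
      preimage of some open \<open>V\<close> inside \<open>U\<close>; points of \<open>N\<close> are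
      in the dense set themselves.\<close>
    proof (cases "y \<in> N")
      case False
      have "z = y" if "z \<in> topspace Y" "q z = q y" for z
        using N(3)[OF yY that(1)] that False by auto
      then have "{z \<in> topspace Y. q z = q y} \<subseteq> U" using y by auto
      then obtain V where V: "openin X V" "q y \<in> V" "{z \<in> topspace Y. q z \<in> V} \<subseteq> U"
        using q U yY unfolding closed_map_fibre_neighbourhood by blast
      then obtain d where "d \<in> D" "d \<in> V"
        using D(3) unfolding dense_intersects_open by blast
      moreover have "d \<in> topspace X" using D(2) \<open>d \<in> D\<close> by blast
      ultimately have "s d \<in> U" using V(3) s by auto
      then show ?thesis using \<open>d \<in> D\<close> by auto
    qed (use y in auto)
  qed
  moreover have "countable (N \<union> s ` D)" "N \<union> s ` D \<subseteq> topspace Y"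
    using N D s by auto
  ultimately show ?thesis unfolding separable_space_def by blast
qed

lemma Hausdorff_space_separate_finite_fibre:
  assumes Y: "Hausdorff_space Y" and fin: "finite {z \<in> topspace Y. q z = q y}"
    and y: "y \<in> topspace Y"
  obtains H L where "openin Y H" "openin Y L" "disjnt H L" "y \<in> H"
    "{z \<in> topspace Y. q z = q y} - {y} \<subseteq> L"
proof -
  have "compactin Y {y}" using y by simp
  moreover have "compactin Y ({z \<in> topspace Y. q z = q y} - {y})"
    using fin by (intro finite_imp_compactin) auto
  moreover have "disjnt {y} ({z \<in> topspace Y. q z = q y} - {y})" by auto
  ultimately obtain H L where "openin Y H" "openin Y L" "{y} \<subseteq> H"
    "{z \<in> topspace Y. q z = q y} - {y} \<subseteq> L" "disjnt H L"
    using Y[unfolded Hausdorff_space_compact_sets, rule_format,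
        of "{y}" "{z \<in> topspace Y. q z = q y} - {y}"] by metis
  then show ?thesis using that by blast
qed

text \<open>Preimages of basic sets suffice at one-point fibres. At \<open>y \<in> N\<close> they
  cannot tell \<open>y\<close> from the rest of its fibre, so they are also intersected with one
  fixed open \<open>H y\<close> that is disjoint from a neighbourhood \<open>L y\<close> of that
  rest.\<close>

lemma second_countable_closed_map_preimage:
  assumes X: "second_countable X" and Y: "Hausdorff_space Y"
    and q: "continuous_map Y X q" "closed_map Y X q"
    and fin: "\<And>x. x \<in> topspace X \<Longrightarrow> finite {y \<in> topspace Y. q y = x}"
    and N: "countable N" "N \<subseteq> topspace Y"
      "\<And>y z. \<lbrakk>y \<in> topspace Y; z \<in> topspace Y; q y = q z; y \<noteq> z\<rbrakk> \<Longrightarrow> y \<in> N"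
  shows "second_countable Y"
proof -
  obtain \<B> where \<B>: "countable \<B>" "\<And>V. V \<in> \<B> \<Longrightarrow> openin X V"
    "\<And>U x. openin X U \<Longrightarrow> x \<in> U \<Longrightarrow> \<exists>V\<in>\<B>. x \<in> V \<and> V \<subseteq> U"
    using X unfolding second_countable_def by metis
  have qY: "q y \<in> topspace X" if "y \<in> topspace Y" for y
    using that q(1) continuous_map_image_subset_topspace by blast
  define sep where "sep y H L \<longleftrightarrow> openin Y H \<and> openin Y L \<and> disjnt H L \<and> y \<in> H \<and>
    {z \<in> topspace Y. q z = q y} - {y} \<subseteq> L" for y H L
  have "\<exists>H L. sep y H L" if "y \<in> topspace Y" for y
    by (rule Hausdorff_space_separate_finite_fibre[OF Y fin[OF qY[OF that]] that])
      (auto simp: sep_def)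
  then obtain H L where "\<And>y. y \<in> topspace Y \<Longrightarrow> sep y (H y) (L y)"
    by metis
  then have HL: "openin Y (H y)" "openin Y (L y)" "disjnt (H y) (L y)" "y \<in> H y"
    "{z \<in> topspace Y. q z = q y} - {y} \<subseteq> L y" if "y \<in> topspace Y" for y
    using that unfolding sep_def by blast+
  have local_base: "\<exists>V\<in>\<B>. q y \<in> V \<and> {z \<in> topspace Y. q z \<in> V} \<subseteq> U"
    if U: "openin Y U" and y: "y \<in> topspace Y" and sub: "{z \<in> topspace Y. q z = q y} \<subseteq> U" for U y
  proof -
    obtain W where W: "openin X W" "q y \<in> W" "{z \<in> topspace Y. q z \<in> W} \<subseteq> U"
      using q(2) U qY[OF y] sub unfolding closed_map_fibre_neighbourhood by blast
    then obtain V where "V \<in> \<B>" "q y \<in> V" "V \<subseteq> W" using \<B>(3) by metis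
    then show ?thesis using W by blast
  qed
  define pre where "pre V = {z \<in> topspace Y. q z \<in> V}" for V
  have pre: "openin Y (pre V)" if "V \<in> \<B>" for V
    using q(1) \<B>(2)[OF that] unfolding pre_def by (rule openin_continuous_map_preimage)
  define \<C> where "\<C> = pre ` \<B> \<union> (\<lambda>(V, y). pre V \<inter> H y) ` (\<B> \<times> N)"
  have "countable \<C>" unfolding \<C>_def using \<B>(1) N(1) by blast
  moreover have "openin Y V" if "V \<in> \<C>" for V
    using that pre HL(1) N(2) unfolding \<C>_def by (auto intro!: openin_Int)
  moreover have "\<exists>V\<in>\<C>. y \<in> V \<and> V \<subseteq> U" if U: "openin Y U" "y \<in> U" for U y
  proof -
    have y: "y \<in> topspace Y" using U openin_subset by blast
    show ?thesis
    proof (cases "y \<in> N")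
      case True
      \<comment> \<open>Adding \<open>L y\<close> turns \<open>U\<close> into a neighbourhood of the
        whole fibre, so a preimage fits inside; intersecting with \<open>H y\<close> discards the
        part in \<open>L y\<close>.\<close>
      have "openin Y (U \<union> L y)" "{z \<in> topspace Y. q z = q y} \<subseteq> U \<union> L y"
        using U HL(2,5)[OF y] by blast+
      then obtain V where V: "V \<in> \<B>" "q y \<in> V" "pre V \<subseteq> U \<union> L y"
        using local_base[OF _ y, folded pre_def] by metis
      have "y \<in> pre V \<inter> H y" using V(2) y HL(4)[OF y] by (simp add: pre_def)
      moreover have "pre V \<inter> H y \<subseteq> U" using V(3) HL(3)[OF y] unfolding disjnt_def by blast
      moreover have "pre V \<inter> H y \<in> \<C>" using V True by (auto simp: \<C>_def)
      ultimately show ?thesis by blast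
    next
      case False
      have "z = y" if "z \<in> topspace Y" "q z = q y" for z
        using N(3)[OF y that(1)] that False by auto
      then have "{z \<in> topspace Y. q z = q y} \<subseteq> U" using U by auto
      then obtain V where "V \<in> \<B>" "q y \<in> V" "pre V \<subseteq> U"
        using local_base[OF U(1) y, folded pre_def] by metis
      moreover from this have "pre V \<in> \<C>" "y \<in> pre V" using y by (auto simp: \<C>_def pre_def)
      ultimately show ?thesis by blast
    qed
  qed
  ultimately show ?thesis unfolding second_countable_def by metis
qed

text \<open>A function pulled back from \<open>X\<close> is constant on fibres. A bump
  \<open>1 - g (q z)\<close> that vanishes outside \<open>H \<union> L\<close> is therefore kept on
  \<open>H\<close> and replaced by 0 on \<open>L\<close>.\<close>

lemma closed_map_fibre_separating_function:
  assumes X: "completely_regular_space X" and Y: "Hausdorff_space Y"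
    and q: "continuous_map Y X q" "closed_map Y X q"
    and fin: "finite {z \<in> topspace Y. q z = q y}" and y: "y \<in> topspace Y"
  obtains f :: "'b \<Rightarrow> real" where "continuous_map Y euclideanreal f" "f y = 1"
    "\<And>z. \<lbrakk>z \<in> topspace Y; q z = q y; z \<noteq> y\<rbrakk> \<Longrightarrow> f z = 0"
proof -
  obtain H L where HL: "openin Y H" "openin Y L" "disjnt H L" "y \<in> H"
    "{z \<in> topspace Y. q z = q y} - {y} \<subseteq> L"
    by (rule Hausdorff_space_separate_finite_fibre[OF Y fin y])
  have qy: "q y \<in> topspace X" using y q(1) continuous_map_image_subset_topspace by blast
  have "openin Y (H \<union> L)" "{z \<in> topspace Y. q z = q y} \<subseteq> H \<union> L" using HL by auto
  then obtain V where V: "openin X V" "q y \<in> V" "{z \<in> topspace Y. q z \<in> V} \<subseteq> H \<union> L"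
    using q(2) qy unfolding closed_map_fibre_neighbourhood by blast
  have "closedin X (topspace X - V)" "q y \<in> topspace X - (topspace X - V)"
    using V qy by auto
  then obtain g :: "'a \<Rightarrow> real" where g: "continuous_map X (top_of_set {0..1}) g" "g (q y) = 0"
    "g ` (topspace X - V) \<subseteq> {1}"
    using X unfolding completely_regular_space_def by meson
  have gq: "continuous_map Y euclideanreal (\<lambda>z. 1 - g (q z))"
    using continuous_map_compose[OF q(1), of euclideanreal g] g(1)
    by (auto simp: continuous_map_in_subtopology o_def intro!: continuous_intros)
  define f where "f z = (if z \<in> H then 1 - g (q z) else 0)" for z
  have out: "g (q z) = 1" if "z \<in> topspace Y" "z \<notin> H" "z \<notin> L" for z
    using that V(3) g(3) q(1) continuous_map_image_subset_topspace by blast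
  \<comment> \<open>The closed sets \<open>topspace Y - L\<close> and \<open>topspace Y - H\<close>
    cover the space, and on their overlap the bump is 0 by \<open>out\<close>, so the two formulas
    agree there.\<close>
  have "continuous_map Y euclideanreal f"
  proof (rule pasting_lemma_closed)
    show "finite {True, False}" by simp
    show "closedin Y (if i then topspace Y - L else topspace Y - H)" for i
      using HL by auto
    show "continuous_map (subtopology Y (if i then topspace Y - L else topspace Y - H)) euclideanreal
        (if i then \<lambda>z. 1 - g (q z) else (\<lambda>z. 0))" for i
      using gq by (auto intro: continuous_map_from_subtopology)
    show "(if i then \<lambda>z. 1 - g (q z) else (\<lambda>z. 0)) x = (if j then \<lambda>z. 1 - g (q z) else (\<lambda>z. 0)) x"
      if "x \<in> topspace Y \<inter> (if i then topspace Y - L else topspace Y - H)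
        \<inter> (if j then topspace Y - L else topspace Y - H)" for i j x
      using that out by (auto split: if_splits)
    show "\<exists>j. j \<in> {True, False} \<and> x \<in> (if j then topspace Y - L else topspace Y - H) \<and>
      f x = (if j then \<lambda>z. 1 - g (q z) else (\<lambda>z. 0)) x" if "x \<in> topspace Y" for x
      using that HL(3) by (intro exI[of _ "x \<in> H"]) (auto simp: f_def disjnt_def)
  qed
  moreover have "f y = 1" using g HL by (simp add: f_def)
  moreover have "f z = 0" if "z \<in> topspace Y" "q z = q y" "z \<noteq> y" for z
    using that HL by (auto simp: f_def disjnt_def)
  ultimately show ?thesis using that by blast
qed

text \<open>A proper map stays proper when it is paired with continuous functions. Adding one function
  for each point of \<open>N\<close> makes it injective, hence an embedding into the product of \<open>X\<close> and
  a countable power of the real line.\<close>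

lemma metrizable_space_closed_map_preimage:
  assumes X: "metrizable_space X" and Y: "Hausdorff_space Y"
    and q: "continuous_map Y X q" "closed_map Y X q"
    and fin: "\<And>x. x \<in> topspace X \<Longrightarrow> finite {y \<in> topspace Y. q y = x}"
    and N: "countable N" "N \<subseteq> topspace Y"
      "\<And>y z. \<lbrakk>y \<in> topspace Y; z \<in> topspace Y; q y = q z; y \<noteq> z\<rbrakk> \<Longrightarrow> y \<in> N"
  shows "metrizable_space Y"
proof -
  have qY: "q y \<in> topspace X" if "y \<in> topspace Y" for y
    using that q(1) continuous_map_image_subset_topspace by blast
  define sep where "sep y f \<longleftrightarrow> continuous_map Y euclideanreal f \<and> f y = 1 \<and>
    (\<forall>z\<in>topspace Y. q z = q y \<and> z \<noteq> y \<longrightarrow> f z = 0)" for y and f :: "'b \<Rightarrow> real"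
  have "\<exists>f. sep y f" if "y \<in> topspace Y" for y
    by (rule closed_map_fibre_separating_function[OF metrizable_imp_completely_regular_space[OF X] Y q
        fin[OF qY[OF that]] that]) (auto simp: sep_def)
  then obtain f where "\<And>y. y \<in> topspace Y \<Longrightarrow> sep y (f y)"
    by metis
  then have f: "continuous_map Y euclideanreal (f y)" "f y y = 1"
    "\<And>z. \<lbrakk>z \<in> topspace Y; q z = q y; z \<noteq> y\<rbrakk> \<Longrightarrow> f y z = 0" if "y \<in> topspace Y" for y
    using that unfolding sep_def by blast+
  define P where "P = product_topology (\<lambda>_. euclideanreal) N"
  define h where "h z = (\<lambda>y\<in>N. f y z)" for z
  have P: "metrizable_space P"
    unfolding P_def metrizable_space_product_topology
    using N(1) by (auto simp: metrizable_space_euclidean intro: countable_subset)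
  have h: "continuous_map Y P h"
    unfolding P_def h_def using f N(2) by (auto simp: continuous_map_componentwise)
  have "proper_map Y X q"
    using q(2) fin by (auto simp: proper_map_def intro: finite_imp_compactin)
  then have "proper_map Y (prod_topology X P) (\<lambda>z. (q z, h z))"
    using h metrizable_imp_Hausdorff_space[OF P] by (intro proper_map_paired) simp
  moreover have "continuous_map Y (prod_topology X P) (\<lambda>z. (q z, h z))"
    using q(1) h by (simp add: continuous_map_pairwise o_def)
  moreover have "inj_on (\<lambda>z. (q z, h z)) (topspace Y)"
  proof (rule inj_onI, rule ccontr)
    fix y z assume yz: "y \<in> topspace Y" "z \<in> topspace Y" "(q y, h y) = (q z, h z)" "y \<noteq> z"
    then have "y \<in> N" using N(3) by blast
    moreover have "h y y = h z y" using yz by simp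
    ultimately have "f y y = f y z" by (simp add: h_def)
    moreover have "q z = q y" "z \<noteq> y" using yz by auto
    ultimately show False using f(2)[OF yz(1)] f(3)[OF yz(1,2)] by simp
  qed
  ultimately have "embedding_map Y (prod_topology X P) (\<lambda>z. (q z, h z))"
    by (intro injective_closed_imp_embedding_map proper_imp_closed_map)
  then have "Y homeomorphic_space subtopology (prod_topology X P) ((\<lambda>z. (q z, h z)) ` topspace Y)"
    by (rule embedding_map_imp_homeomorphic_space)
  moreover have "metrizable_space (subtopology (prod_topology X P) ((\<lambda>z. (q z, h z)) ` topspace Y))"
    using X P by (intro metrizable_space_subtopology) (simp add: metrizable_space_prod_topology)
  ultimately show ?thesis using homeomorphic_metrizable_space by blast
qed

section \<open>Circular orders as cut linear orders\<close>

locale circular_order =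
  fixes X :: "'a set" and R :: "('a \<times> 'a \<times> 'a) set"
  assumes circ: "circular_order_on X R"
begin

lemma in_carrier: "(a, b, c) \<in> R \<Longrightarrow> a \<in> X \<and> b \<in> X \<and> c \<in> X"
  using circ[unfolded circular_order_on_def, THEN conjunct1] by auto

lemma cyclic: "(a, b, c) \<in> R \<Longrightarrow> (b, c, a) \<in> R"
  using circ unfolding circular_order_on_def by metis

lemma asym: "(a, b, c) \<in> R \<Longrightarrow> (c, b, a) \<notin> R"
  using circ unfolding circular_order_on_def by metis

lemma trans: "(a, b, c) \<in> R \<Longrightarrow> (a, c, d) \<in> R \<Longrightarrow> (a, b, d) \<in> R"
  using circ unfolding circular_order_on_def by metis

lemma total: "\<lbrakk>a \<in> X; b \<in> X; c \<in> X; a \<noteq> b; b \<noteq> c; a \<noteq> c\<rbrakk> \<Longrightarrow> (a, b, c) \<in> R \<or> (a, c, b) \<in> R"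
  using circ unfolding circular_order_on_def by metis

lemma distinct3: "(a, b, c) \<in> R \<Longrightarrow> a \<noteq> b \<and> b \<noteq> c \<and> a \<noteq> c"
  using asym cyclic by metis

text \<open>The circle is cut open just before \<open>m\<close>, which becomes the least point.
  Triples of \<open>R\<close> have distinct entries, so the disjunct \<open>x = m\<close> is what
  compares \<open>m\<close> with the other points.\<close>

definition cut_less :: "'a \<Rightarrow> 'a \<Rightarrow> 'a \<Rightarrow> bool" where
  "cut_less m x y \<longleftrightarrow> x \<in> X \<and> y \<in> X \<and> x \<noteq> y \<and> (x = m \<or> (m, x, y) \<in> R)"

lemma cut_less_asym: "m \<in> X \<Longrightarrow> cut_less m x y \<Longrightarrow> \<not> cut_less m y x"
  unfolding cut_less_def using distinct3 cyclic asym by metis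

lemma cut_less_trans:
  assumes "m \<in> X" "cut_less m x y" "cut_less m y z"
  shows "cut_less m x z"
  using assms cut_less_asym[OF assms(1,2)] trans[of m x y z] distinct3 unfolding cut_less_def by metis

lemma cut_less_total: "\<lbrakk>m \<in> X; x \<in> X; y \<in> X; x \<noteq> y\<rbrakk> \<Longrightarrow> cut_less m x y \<or> cut_less m y x"
  unfolding cut_less_def using total[of m x y] by auto

lemma cut_less_imp:
  assumes "cut_less m x y" "cut_less m y z" "m \<in> X"
  shows "(x, y, z) \<in> R"
proof (cases "x = m")
  case False
  then have "(m, x, y) \<in> R" "(m, y, z) \<in> R"
    using assms distinct3 unfolding cut_less_def by metis+
  then have "(y, m, x) \<in> R" "(y, z, m) \<in> R" using cyclic by metis+
  then have "(y, z, x) \<in> R" using trans by metis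
  then show ?thesis using cyclic by metis
next
  case True
  then show ?thesis using assms cut_less_asym[OF assms(3,1)] unfolding cut_less_def by auto
qed

text \<open>Three distinct points form one of six chains in the cut order, and the three chains of
  the wrong orientation would put the reversed triple into \<open>R\<close>. Rewriting with this
  equivalence reduces questions about arcs to a linear order.\<close>

lemma triple_iff_cut:
  assumes m: "m \<in> X"
  shows "(x, y, z) \<in> R \<longleftrightarrow> (cut_less m x y \<and> cut_less m y z) \<or> (cut_less m y z \<and> cut_less m z x) \<or>
    (cut_less m z x \<and> cut_less m x y)" (is "_ \<longleftrightarrow> ?rhs")
proof
  assume R: "(x, y, z) \<in> R"
  then have "\<not> (cut_less m z y \<and> cut_less m y x)" "\<not> (cut_less m y x \<and> cut_less m x z)"
    "\<not> (cut_less m x z \<and> cut_less m z y)"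
    using cut_less_imp[OF _ _ m] cyclic asym by metis+
  then show ?rhs using cut_less_total[OF m] in_carrier[OF R] distinct3[OF R] by metis
next
  assume ?rhs
  then show "(x, y, z) \<in> R" using cut_less_imp[OF _ _ m] cyclic by metis
qed

lemma openin_arc_complement:
  "a \<in> X \<Longrightarrow> b \<in> X \<Longrightarrow> openin (circ_topology X R) (X - circ_closed_interval X R a b)"
  unfolding circ_topology_def by (rule topology_generated_by_Basis) (auto simp: circ_base_def)

lemma mem_arc_complement:
  "x \<in> X - circ_closed_interval X R a b \<longleftrightarrow> x \<in> X \<and> x \<noteq> a \<and> x \<noteq> b \<and> (a, x, b) \<notin> R"
  by (auto simp: circ_closed_interval_def circ_open_interval_def)

lemma openin_imp_arc_complement:
  assumes U: "openin (circ_topology X R) U" and x: "x \<in> U"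
  obtains "U = X" | a b where "a \<in> X" "b \<in> X" "x \<in> X - circ_closed_interval X R a b"
    "X - circ_closed_interval X R a b \<subseteq> U"
proof -
  obtain B where B: "B \<in> circ_base X R" "x \<in> B" "B \<subseteq> U"
    using U x unfolding openin_circ_topology[OF circ] arbitrary_union_of_alt by blast
  have "U \<subseteq> X" using openin_subset[OF U] by (simp add: topspace_circ_topology)
  then show ?thesis using B that unfolding circ_base_def by auto
qed

text \<open>By \<open>jump\<close> the open arc from \<open>p\<close> to \<open>m\<close> is empty,
  so cutting there tears no neighbourhood apart: \<open>m\<close> becomes the least and
  \<open>p\<close> the greatest element, and each ray is the complement of an arc with an end at
  \<open>m\<close> or \<open>p\<close>.\<close>

lemma LOTS_if_jump:
  assumes m: "m \<in> X" and p: "p \<in> X" "m \<noteq> p"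
    and jump: "\<And>u. \<lbrakk>u \<in> X; u \<noteq> m; u \<noteq> p\<rbrakk> \<Longrightarrow> (m, u, p) \<in> R"
  shows "LOTS (circ_topology X R)"
proof -
  define lt where "lt = cut_less m"
  define r where "r = {(x, y). x \<in> X \<and> y \<in> X \<and> (x = y \<or> lt x y)}"
  have lt: "lt x y \<Longrightarrow> x \<in> X \<and> y \<in> X \<and> x \<noteq> y" for x y
    by (auto simp: lt_def cut_less_def)
  note as = cut_less_asym[OF m, folded lt_def] and tr = cut_less_trans[OF m, folded lt_def]
    and tot = cut_less_total[OF m, folded lt_def] and R_iff = triple_iff_cut[OF m, folded lt_def]
  have min: "u \<in> X \<Longrightarrow> u \<noteq> m \<Longrightarrow> lt m u" for u
    using m by (auto simp: lt_def cut_less_def)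
  have max: "u \<in> X \<Longrightarrow> u \<noteq> p \<Longrightarrow> lt u p" for u
    using m p jump by (auto simp: lt_def cut_less_def)
  have p_max: "\<not> lt p u" and m_min: "\<not> lt u m" for u
    using max min as lt by metis+
  have below: "{x \<in> X. (x, a) \<in> r \<and> x \<noteq> a} = {x. lt x a}"
    and above: "{x \<in> X. (a, x) \<in> r \<and> x \<noteq> a} = {x. lt a x}" if "a \<in> X" for a
    using that lt by (auto simp: r_def)
  define S where "S = {{x. lt x a} | a. a \<in> X} \<union> {{x. lt a x} | a. a \<in> X} \<union> {X}"
  have lot: "linear_order_topology X r = topology_generated_by S"
    unfolding linear_order_topology_def S_def setcompr_eq_image
    using below above by (simp cong: image_cong_simp)
  have lin: "linear_order_on X r"
    unfolding linear_order_on_def partial_order_on_def preorder_on_def refl_on_def trans_def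
      antisym_def total_on_def r_def
    using as tr tot by blast
  have openS: "openin (topology_generated_by S) s" if "s \<in> S" for s
    using that by (rule topology_generated_by_Basis)
  have "{x. lt x a} \<in> S" "{x. lt a x} \<in> S" if "a \<in> X" for a
    using that unfolding S_def by auto
  then have open_ray: "openin (topology_generated_by S) {x. lt x a}" "openin (topology_generated_by S) {x. lt a x}"
    if "a \<in> X" for a
    using that openS by blast+
  have "openin (topology_generated_by S) U = openin (circ_topology X R) U" for U
  proof
    assume "openin (topology_generated_by S) U"
    then have "generate_topology_on S U" by (simp add: openin_topology_generated_by_iff)
    then show "openin (circ_topology X R) U"
    proof induction
      case (Basis s)
      \<comment> \<open>The arc from \<open>a\<close> to \<open>p\<close> runs up to the maximum and
        leaves exactly the points below \<open>a\<close>; dually, the arc from \<open>m\<close> to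
        \<open>a\<close> leaves those above \<open>a\<close>.\<close>
      have "x \<in> X - circ_closed_interval X R a p \<longleftrightarrow> lt x a" if "a \<in> X" for a x
        unfolding mem_arc_complement R_iff using that p_max by (metis lt as tot max)
      then have "{x. lt x a} = X - circ_closed_interval X R a p" if "a \<in> X" for a
        using that by blast
      moreover have "x \<in> X - circ_closed_interval X R m a \<longleftrightarrow> lt a x" if "a \<in> X" for a x
        unfolding mem_arc_complement R_iff using that m_min by (metis lt as tot min)
      then have "{x. lt a x} = X - circ_closed_interval X R m a" if "a \<in> X" for a
        using that by blast
      moreover have "openin (circ_topology X R) X"
        using openin_topspace[of "circ_topology X R"] by (simp add: topspace_circ_topology)
      ultimately show ?case using Basis openin_arc_complement m p by (auto simp: S_def)
    qed auto
  next
    assume "openin (circ_topology X R) U"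
    then have "generate_topology_on (circ_base X R) U"
      by (simp add: circ_topology_def openin_topology_generated_by_iff)
    then show "openin (topology_generated_by S) U"
    proof induction
      case (Basis s)
      have "openin (topology_generated_by S) (X - circ_closed_interval X R a b)"
        if ab: "a \<in> X" "b \<in> X" for a b
      \<comment> \<open>If \<open>b\<close> precedes \<open>a\<close>, the removed arc runs through
        the cut and its complement is one open interval; otherwise the complement runs through the
        cut and splits into two rays.\<close>
      proof (cases "lt b a")
        case True
        then have "x \<in> X - circ_closed_interval X R a b \<longleftrightarrow> lt b x \<and> lt x a" for x
          unfolding mem_arc_complement R_iff using ab by (metis lt as tr tot)
        then have "X - circ_closed_interval X R a b = {x. lt b x} \<inter> {x. lt x a}" by blast
        then show ?thesis using open_ray ab by (simp only: openin_Int)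
      next
        case False
        then have "x \<in> X - circ_closed_interval X R a b \<longleftrightarrow> lt x a \<or> lt b x" for x
          unfolding mem_arc_complement R_iff using ab by (metis lt as tr tot)
        then have "X - circ_closed_interval X R a b = {x. lt x a} \<union> {x. lt b x}" by blast
        then show ?thesis using open_ray ab by (simp only: openin_Un)
      qed
      then show ?case using Basis openS[of X] by (auto simp: circ_base_def S_def)
    qed auto
  qed
  then have "circ_topology X R = linear_order_topology X r"
    unfolding lot by (simp add: topology_eq)
  then show ?thesis unfolding LOTS_def topspace_circ_topology using lin by blast
qed

end

section \<open>Separation in linearly ordered spaces\<close>

lemma LOTS_imp_Hausdorff_space:
  assumes "LOTS T"
  shows "Hausdorff_space T"
proof -
  define X where "X = topspace T"
  obtain r where r: "linear_order_on X r" and T: "T = linear_order_topology X r"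
    using assms unfolding LOTS_def X_def by blast
  define lo where "lo a = {x \<in> X. (x, a) \<in> r \<and> x \<noteq> a}" for a
  define up where "up a = {x \<in> X. (a, x) \<in> r \<and> x \<noteq> a}" for a
  have "openin T (lo a) \<and> openin T (up a)" if "a \<in> X" for a
    unfolding T linear_order_topology_def lo_def up_def using that
    by (intro conjI topology_generated_by_Basis) auto
  note op = this
  have anti: "(x, y) \<in> r \<Longrightarrow> (y, x) \<in> r \<Longrightarrow> x = y" for x y
    using r by (auto simp: linear_order_on_def partial_order_on_def antisym_def)
  have tr: "(x, y) \<in> r \<Longrightarrow> (y, z) \<in> r \<Longrightarrow> (x, z) \<in> r" for x y z
    using r unfolding linear_order_on_def partial_order_on_def preorder_on_def trans_def by blast
  have tot: "x \<in> X \<Longrightarrow> y \<in> X \<Longrightarrow> x \<noteq> y \<Longrightarrow> (x, y) \<in> r \<or> (y, x) \<in> r" for x y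
    using r by (auto simp: linear_order_on_def total_on_def)
  have sep: "\<exists>U V. openin T U \<and> openin T V \<and> x \<in> U \<and> y \<in> V \<and> disjnt U V"
    if xy: "x \<in> X" "y \<in> X" "(x, y) \<in> r" "x \<noteq> y" for x y
  \<comment> \<open>An intermediate \<open>z\<close> gives the rays below and above
    \<open>z\<close>; without one, the rays below \<open>y\<close> and above \<open>x\<close> are
    already disjoint.\<close>
  proof (cases "\<exists>z\<in>X. (x, z) \<in> r \<and> (z, y) \<in> r \<and> z \<noteq> x \<and> z \<noteq> y")
    case True
    then obtain z where "z \<in> X" "(x, z) \<in> r" "(z, y) \<in> r" "z \<noteq> x" "z \<noteq> y" by blast
    moreover from this have "disjnt (lo z) (up z)"
      using anti by (auto simp: disjnt_def lo_def up_def)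
    ultimately show ?thesis using op xy by (intro exI[of _ "lo z"] exI[of _ "up z"]) (auto simp: lo_def up_def)
  next
    case False
    then have "disjnt (lo y) (up x)" by (auto simp: disjnt_def lo_def up_def)
    then show ?thesis using op xy by (intro exI[of _ "lo y"] exI[of _ "up x"]) (auto simp: lo_def up_def)
  qed
  show ?thesis
    unfolding Hausdorff_space_def X_def[symmetric]
  proof (intro allI impI)
    fix x y assume "x \<in> X \<and> y \<in> X \<and> x \<noteq> y"
    then show "\<exists>U V. openin T U \<and> openin T V \<and> x \<in> U \<and> y \<in> V \<and> disjnt U V"
      using sep[of x y] sep[of y x] tot[of x y] by (metis disjnt_sym)
  qed
qed

section \<open>The split space\<close>

text \<open>\<open>Minus a\<close> lies in \<open>Split X A\<close> only for
  \<open>a \<in> A\<close>, so the union over \<open>A\<close> becomes an unbounded existential,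
  with one disjunct for each rotation of a twin triple.\<close>

lemma split_order_iff:
  "(u, w, v) \<in> split_order X R A \<longleftrightarrow>
    u \<in> Split X A \<and> w \<in> Split X A \<and> v \<in> Split X A \<and>
     ((split_proj u, split_proj w, split_proj v) \<in> R \<or>
      (\<exists>a. u = Minus a \<and> v = Plus a \<and> w \<noteq> u \<and> w \<noteq> v) \<or>
      (\<exists>a. v = Minus a \<and> w = Plus a \<and> u \<noteq> v \<and> u \<noteq> w) \<or>
      (\<exists>a. w = Minus a \<and> u = Plus a \<and> v \<noteq> u \<and> v \<noteq> w))"
  unfolding split_order_def Split_def by auto

lemma split_proj_eq:
  assumes "u \<in> Split X A" "v \<in> Split X A" "split_proj u = split_proj v"
  obtains "u = v" | a where "a \<in> A" "u = Minus a" "v = Plus a" | a where "a \<in> A" "u = Plus a" "v = Minus a"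
  using assms unfolding Split_def by auto

locale split_circular_order = circular_order +
  fixes A :: "'a set"
  assumes A: "A \<subseteq> X"
begin

abbreviation "XA \<equiv> Split X A"
abbreviation "RA \<equiv> split_order X R A"
abbreviation "TX \<equiv> circ_topology X R"
abbreviation "TA \<equiv> circ_topology XA RA"

lemma split_proj_in: "u \<in> XA \<Longrightarrow> split_proj u \<in> X"
  using A by (auto simp: Split_def)

lemma split_proj_image: "split_proj ` XA = X"
  using A by (auto simp: Split_def image_Un image_image)

lemma fibre_in: "a \<in> A \<Longrightarrow> {u \<in> XA. split_proj u = a} = {Minus a, Plus a}"
  by (auto simp: Split_def)

lemma fibre_out: "x \<in> X - A \<Longrightarrow> {u \<in> XA. split_proj u = x} = {Keep x}"
  by (auto simp: Split_def)

lemma finite_fibre: "finite {u \<in> XA. split_proj u = x}"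
proof -
  have "{u \<in> XA. split_proj u = x} \<subseteq> {Minus x, Plus x, Keep x}" by (auto simp: Split_def)
  then show ?thesis by (rule finite_subset) simp
qed

lemma circular_order_split: "circular_order_on XA RA"
  unfolding circular_order_on_def
proof (intro conjI allI impI ballI)
  show "RA \<subseteq> XA \<times> XA \<times> XA" by (auto simp: split_order_iff)
next
  fix a b c assume "(a, b, c) \<in> RA"
  then show "(b, c, a) \<in> RA" unfolding split_order_iff
    using cyclic[of "split_proj a" "split_proj b" "split_proj c"] by blast
next
  fix a b c assume "(a, b, c) \<in> RA"
  then show "(c, b, a) \<notin> RA" unfolding split_order_iff
    using asym[of "split_proj a" "split_proj b" "split_proj c"]
      distinct3[of "split_proj a" "split_proj b" "split_proj c"]
      distinct3[of "split_proj c" "split_proj b" "split_proj a"]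
    by (elim conjE disjE exE) auto
next
  fix a b c d assume abcd: "(a, b, c) \<in> RA \<and> (a, c, d) \<in> RA"
  show "(a, b, d) \<in> RA"
    using abcd trans[of "split_proj a" "split_proj b" "split_proj c" "split_proj d"]
      distinct3[of "split_proj a" "split_proj b" "split_proj c"]
      distinct3[of "split_proj a" "split_proj c" "split_proj d"]
    unfolding split_order_iff by (elim conjE disjE exE) auto
next
  fix a b c assume abc: "a \<in> XA" "b \<in> XA" "c \<in> XA" "a \<noteq> b \<and> b \<noteq> c \<and> a \<noteq> c"
  show "(a, b, c) \<in> RA \<or> (a, c, b) \<in> RA"
  proof (cases "split_proj a \<noteq> split_proj b \<and> split_proj b \<noteq> split_proj c \<and> split_proj a \<noteq> split_proj c")
    case True
    then show ?thesis using total split_proj_in abc unfolding split_order_iff by blast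
  next
    case False
    \<comment> \<open>Distinct points with equal projection are the twins of a split point, and the
      added triples orient any third point relative to them.\<close>
    then consider "split_proj a = split_proj b" | "split_proj b = split_proj c" | "split_proj a = split_proj c"
      by blast
    then show ?thesis
    proof cases
      case 1
      from abc(1,2) 1 show ?thesis
        by (cases rule: split_proj_eq) (use abc in \<open>auto simp: split_order_iff\<close>)
    next
      case 2
      from abc(2,3) 2 show ?thesis
        by (cases rule: split_proj_eq) (use abc in \<open>auto simp: split_order_iff\<close>)
    next
      case 3
      from abc(1,3) 3 show ?thesis
        by (cases rule: split_proj_eq) (use abc in \<open>auto simp: split_order_iff\<close>)
    qed
  qed
qed

sublocale split: circular_order XA RA
  by unfold_locales (rule circular_order_split)

text \<open>An added triple has two entries with equal projection, so (COP1) meets only triples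
  coming from \<open>R\<close>. In (COP2) the direction matters: the closed arc from
  \<open>Plus a\<close> to \<open>Minus a\<close> is just the two twins, while the opposite one is
  the whole space.\<close>

lemma COP_split_proj: "COP XA RA X R split_proj"
  unfolding COP_def
proof (intro conjI allI impI ballI)
  show "split_proj \<in> XA \<rightarrow> X" using split_proj_in by auto
next
  fix a b c
  assume "(a, b, c) \<in> RA \<and> split_proj a \<noteq> split_proj b \<and> split_proj b \<noteq> split_proj c \<and> split_proj a \<noteq> split_proj c"
  then show "(split_proj a, split_proj b, split_proj c) \<in> R"
    by (auto simp: split_order_iff)
next
  fix x y assume xy: "x \<in> XA" "y \<in> XA" "split_proj x = split_proj y"
  have refl: "circ_closed_interval XA RA z z = {z}" for z
    using split.distinct3 by (auto simp: circ_closed_interval_def circ_open_interval_def)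
  have jump: "circ_closed_interval XA RA (Plus a) (Minus a) = {Plus a, Minus a}" for a
    using distinct3 by (auto simp: circ_closed_interval_def circ_open_interval_def split_order_iff)
  from xy show "split_proj constant_on circ_closed_interval XA RA x y \<or>
      split_proj constant_on circ_closed_interval XA RA y x"
    by (cases rule: split_proj_eq) (auto simp: refl jump constant_on_def)
qed

lemma LOTS_split:
  assumes "A \<noteq> {}"
  shows "LOTS TA"
proof -
  obtain a where "a \<in> A" using assms by blast
  then show ?thesis
    by (intro split.LOTS_if_jump[of "Minus a" "Plus a"]) (auto simp: split_order_iff Split_def)
qed

text \<open>The preimage of \<open>[a, b]\<close> is the interval from the first point over \<open>a\<close> (namely
  \<open>Plus a\<close>, if \<open>a\<close> is split) to the last point over \<open>b\<close> (namely \<open>Minus b\<close>).\<close>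

lemma continuous_map_split_proj: "continuous_map TA TX split_proj"
proof -
  have op: "openin TA {u \<in> XA. split_proj u \<in> X - circ_closed_interval X R a b}"
    if ab: "a \<in> X" "b \<in> X" for a b
  proof -
    define l where "l = (if a \<in> A then Plus a else Keep a)"
    define h where "h = (if b \<in> A then Minus b else Keep b)"
    have lh: "l \<in> XA" "h \<in> XA" using ab by (auto simp: l_def h_def Split_def)
    have ends: "split_proj l = a" "split_proj h = b" "l \<noteq> Minus c" "h \<noteq> Plus c" for c
      by (simp_all add: l_def h_def)
    have "split_proj u \<in> X - circ_closed_interval X R a b \<longleftrightarrow> u \<in> XA - circ_closed_interval XA RA l h"
      if u: "u \<in> XA" for u
    proof
      assume "split_proj u \<in> X - circ_closed_interval X R a b"
      then have "split_proj u \<noteq> a" "split_proj u \<noteq> b" "(a, split_proj u, b) \<notin> R"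
        unfolding mem_arc_complement by auto
      then show "u \<in> XA - circ_closed_interval XA RA l h"
        unfolding split.mem_arc_complement using u ends by (auto simp: split_order_iff)
    next
      assume "u \<in> XA - circ_closed_interval XA RA l h"
      then have ne: "u \<noteq> l" "u \<noteq> h" "(l, u, h) \<notin> RA"
        unfolding split.mem_arc_complement by auto
      \<comment> \<open>\<open>Minus a\<close> follows \<open>Plus a\<close> immediately, so the
        other point over \<open>a\<close> would lie on the removed arc starting at \<open>l\<close>;
        likewise for \<open>Plus b\<close> at the end \<open>h\<close>.\<close>
      have "split_proj u \<noteq> a"
      proof
        assume "split_proj u = a"
        then have "u = Minus a" "l = Plus a" using u ne by (auto simp: l_def Split_def)
        then show False using ne u lh ends by (auto simp: split_order_iff)
      qed
      moreover have "split_proj u \<noteq> b"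
      proof
        assume "split_proj u = b"
        then have "u = Plus b" "h = Minus b" using u ne by (auto simp: h_def Split_def)
        then show False using ne u lh ends by (auto simp: split_order_iff)
      qed
      moreover have "(a, split_proj u, b) \<notin> R"
        using ne u lh ends by (auto simp: split_order_iff)
      ultimately show "split_proj u \<in> X - circ_closed_interval X R a b"
        unfolding mem_arc_complement using split_proj_in u by blast
    qed
    then have "{u \<in> XA. split_proj u \<in> X - circ_closed_interval X R a b} = XA - circ_closed_interval XA RA l h"
      by blast
    then show ?thesis using split.openin_arc_complement lh by simp
  qed
  have "{u \<in> XA. split_proj u \<in> X} = topspace TA"
    using split_proj_in by (auto simp: topspace_circ_topology)
  then have "openin TA {u \<in> XA. split_proj u \<in> X}" by simp
  then show ?thesis
    unfolding circ_topology_def[of X]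
    by (intro continuous_on_generated_topo)
      (use op split_proj_in in \<open>auto simp: circ_base_def topspace_circ_topology vimage_def Int_def conj_commute\<close>)
qed

section \<open>Closedness of the projection\<close>

text \<open>Away from the fibres of \<open>u\<close> and \<open>v\<close>, a triple
  \<open>(u, z, v)\<close> that does not come from \<open>R\<close> requires
  \<open>u = Minus b\<close> and \<open>v = Plus b\<close>. The closed arc is then the whole space,
  which the existence of \<open>w\<close> rules out.\<close>

lemma arc_complement_descends:
  assumes uv: "u \<in> XA" "v \<in> XA" and w: "w \<in> XA - circ_closed_interval XA RA u v"
    and ne: "split_proj w \<noteq> split_proj u" "split_proj w \<noteq> split_proj v"
  shows "split_proj w \<in> X - circ_closed_interval X R (split_proj u) (split_proj v)"
    and "{z \<in> XA. split_proj z \<in> X - circ_closed_interval X R (split_proj u) (split_proj v)}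
      \<subseteq> XA - circ_closed_interval XA RA u v"
proof -
  have w': "w \<noteq> u" "w \<noteq> v" "(u, w, v) \<notin> RA" "w \<in> XA"
    using w unfolding split.mem_arc_complement by auto
  then show "split_proj w \<in> X - circ_closed_interval X R (split_proj u) (split_proj v)"
    using ne uv split_proj_in unfolding mem_arc_complement by (auto simp: split_order_iff)
  show "{z \<in> XA. split_proj z \<in> X - circ_closed_interval X R (split_proj u) (split_proj v)}
      \<subseteq> XA - circ_closed_interval XA RA u v"
  proof
    fix z assume "z \<in> {z \<in> XA. split_proj z \<in> X - circ_closed_interval X R (split_proj u) (split_proj v)}"
    then have "z \<in> XA" "split_proj z \<noteq> split_proj u" "split_proj z \<noteq> split_proj v"
      "(split_proj u, split_proj z, split_proj v) \<notin> R"
      unfolding mem_Collect_eq mem_arc_complement by auto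
    then show "z \<in> XA - circ_closed_interval XA RA u v"
      unfolding split.mem_arc_complement using w' ne uv by (auto simp: split_order_iff)
  qed
qed

text \<open>In the critical case each twin over \<open>x\<close> yields only a one-sided
  neighbourhood. In the order cut at \<open>Minus x\<close> these are an initial and a final
  segment, and the gap between them projects into an arc that avoids \<open>x\<close>.\<close>

lemma closed_map_split_proj: "closed_map TA TX split_proj"
  unfolding closed_map_fibre_neighbourhood topspace_circ_topology
proof (intro conjI allI impI)
  show "split_proj \<in> XA \<rightarrow> X" using split_proj_in by auto
next
  fix U x assume "openin TA U \<and> x \<in> X \<and> {u \<in> XA. split_proj u = x} \<subseteq> U"
  then have U: "openin TA U" and x: "x \<in> X" and sub: "{u \<in> XA. split_proj u = x} \<subseteq> U" by auto
  define goal where "goal \<longleftrightarrow> (\<exists>V. openin TX V \<and> x \<in> V \<and> {u \<in> XA. split_proj u \<in> V} \<subseteq> U)"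
  have whole: goal if "XA \<subseteq> U"
    unfolding goal_def using that x openin_topspace[of TX]
    by (intro exI[of _ X]) (auto simp: topspace_circ_topology)
  \<comment> \<open>An arc complement around a point over \<open>x\<close> descends when neither end
    of the arc lies over \<open>x\<close>, so only arcs with an end in the fibre remain.\<close>
  have arc: "goal \<or> split_proj u = x \<or> split_proj v = x"
    if "u \<in> XA" "v \<in> XA" "w \<in> XA - circ_closed_interval XA RA u v" "split_proj w = x"
      "XA - circ_closed_interval XA RA u v \<subseteq> U" for u v w
  proof (rule ccontr)
    assume neg: "\<not> (goal \<or> split_proj u = x \<or> split_proj v = x)"
    define V where "V = X - circ_closed_interval X R (split_proj u) (split_proj v)"
    have "split_proj w \<noteq> split_proj u" "split_proj w \<noteq> split_proj v" using neg that(4) by auto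
    note d = arc_complement_descends[OF that(1-3) this, folded V_def]
    have "openin TX V"
      unfolding V_def using that(1,2) by (intro openin_arc_complement split_proj_in)
    moreover have "x \<in> V" using d(1) that(4) by simp
    moreover have "{u \<in> XA. split_proj u \<in> V} \<subseteq> U" using d(2) that(5) by (rule subset_trans)
    ultimately show False using neg unfolding goal_def by blast
  qed
  have goal
  proof (cases "x \<in> A")
    case False
    then have k: "Keep x \<in> U" "Keep x \<in> XA" using x sub by (auto simp: Split_def)
    have *: "split_proj u \<noteq> x" if "u \<in> XA" "u \<noteq> Keep x" for u
      using that False by (auto simp: Split_def)
    from U k(1) show ?thesis
    proof (cases rule: split.openin_imp_arc_complement)
      case (2 u v)
      then have "u \<noteq> Keep x" "v \<noteq> Keep x" unfolding split.mem_arc_complement by auto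
      then show ?thesis using arc[OF 2(1,2,3) _ 2(4)] *[OF 2(1)] *[OF 2(2)] by auto
    qed (use whole in auto)
  next
    case True
    then have mp: "Minus x \<in> U" "Plus x \<in> U" "Minus x \<in> XA" "Plus x \<in> XA"
      using sub by (auto simp: Split_def)
    have over: "u = Minus x \<or> u = Plus x" if "u \<in> XA" "split_proj u = x" for u
      using that True by (auto simp: Split_def)
    \<comment> \<open>The critical neighbourhood of \<open>Minus x\<close> omits an arc from some
      \<open>u\<close> to \<open>Plus x\<close>. The end \<open>Plus x\<close> lies in
      \<open>U\<close> anyway, so only \<open>z = u\<close> has to be excepted.\<close>
    have right: "goal \<or> (\<exists>u\<in>XA. split_proj u \<noteq> x \<and> (\<forall>z\<in>XA. (u, z, Plus x) \<notin> RA \<and> z \<noteq> u \<longrightarrow> z \<in> U))"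
    proof -
      from U mp(1) show ?thesis
      proof (cases rule: split.openin_imp_arc_complement)
        case (2 u v)
        have nm: "u \<noteq> Minus x" "v \<noteq> Minus x" "(u, Minus x, v) \<notin> RA"
          using 2(3)[unfolded split.mem_arc_complement] by auto
        consider goal | "split_proj u = x" | "split_proj v = x" "split_proj u \<noteq> x"
          using arc[OF 2(1,2,3) _ 2(4)] by auto
        then show ?thesis
        proof cases
          assume "split_proj u = x"
          then have u: "u = Plus x" using over 2 nm by blast
          \<comment> \<open>\<open>Minus x\<close> follows \<open>Plus x\<close> immediately but is
            not on the arc, so the arc is the single point \<open>Plus x\<close>, which belongs to
            \<open>U\<close>.\<close>
          then have "v = Plus x" using nm 2 mp by (auto simp: split_order_iff)
          then have "z \<in> U" if "z \<in> XA" "z \<noteq> Plus x" for z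
            using that u 2(4) split.distinct3[of u z v] unfolding subset_iff split.mem_arc_complement by blast
          then have "XA \<subseteq> U" using mp by blast
          then show ?thesis using whole by blast
        next
          assume "split_proj v = x" "split_proj u \<noteq> x"
          then have "v = Plus x" using over 2 nm by blast
          then have "z \<in> U" if "z \<in> XA" "(u, z, Plus x) \<notin> RA" "z \<noteq> u" for z
            using that 2(4) mp(2) unfolding subset_iff split.mem_arc_complement by blast
          then show ?thesis using 2(1) \<open>split_proj u \<noteq> x\<close> by blast
        qed blast
      qed (use whole in auto)
    qed
    \<comment> \<open>The mirror image at \<open>Plus x\<close>, for an arc that begins at
      \<open>Minus x\<close>.\<close>
    have left: "goal \<or> (\<exists>t\<in>XA. split_proj t \<noteq> x \<and> (\<forall>z\<in>XA. (Minus x, z, t) \<notin> RA \<and> z \<noteq> t \<longrightarrow> z \<in> U))"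
    proof -
      from U mp(2) show ?thesis
      proof (cases rule: split.openin_imp_arc_complement)
        case (2 s t)
        have nm: "s \<noteq> Plus x" "t \<noteq> Plus x" "(s, Plus x, t) \<notin> RA"
          using 2(3)[unfolded split.mem_arc_complement] by auto
        consider goal | "split_proj t = x" | "split_proj s = x" "split_proj t \<noteq> x"
          using arc[OF 2(1,2,3) _ 2(4)] by auto
        then show ?thesis
        proof cases
          assume "split_proj t = x"
          then have t: "t = Minus x" using over 2 nm by blast
          then have "s = Minus x" using nm 2 mp by (auto simp: split_order_iff)
          then have "z \<in> U" if "z \<in> XA" "z \<noteq> Minus x" for z
            using that t 2(4) split.distinct3[of s z t] unfolding subset_iff split.mem_arc_complement by blast
          then have "XA \<subseteq> U" using mp by blast
          then show ?thesis using whole by blast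
        next
          assume "split_proj s = x" "split_proj t \<noteq> x"
          then have "s = Minus x" using over 2 nm by blast
          then have "z \<in> U" if "z \<in> XA" "(Minus x, z, t) \<notin> RA" "z \<noteq> t" for z
            using that 2(4) mp(1) unfolding subset_iff split.mem_arc_complement by blast
          then show ?thesis using 2(2) \<open>split_proj t \<noteq> x\<close> by blast
        qed blast
      qed (use whole in auto)
    qed
    show ?thesis
    proof (rule ccontr)
      assume ng: "\<not> goal"
      obtain u where u: "u \<in> XA" "split_proj u \<noteq> x"
        "\<And>z. \<lbrakk>z \<in> XA; (u, z, Plus x) \<notin> RA; z \<noteq> u\<rbrakk> \<Longrightarrow> z \<in> U"
        using right ng by blast
      obtain t where t: "t \<in> XA" "split_proj t \<noteq> x"
        "\<And>z. \<lbrakk>z \<in> XA; (Minus x, z, t) \<notin> RA; z \<noteq> t\<rbrakk> \<Longrightarrow> z \<in> U"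
        using left ng by blast
      \<comment> \<open>The cut between the twins puts \<open>Minus x\<close> first and
        \<open>Plus x\<close> last, so the segments below \<open>u\<close> and above
        \<open>t\<close> lie in \<open>U\<close>.\<close>
      define lt where "lt = split.cut_less (Minus x)"
      note as = split.cut_less_asym[OF mp(3), folded lt_def]
        and tr = split.cut_less_trans[OF mp(3), folded lt_def]
        and tot = split.cut_less_total[OF mp(3), folded lt_def]
        and R_iff = split.triple_iff_cut[OF mp(3), folded lt_def]
        and imp = split.cut_less_imp[OF _ _ mp(3), folded lt_def]
      have in_XA: "lt w z \<Longrightarrow> w \<in> XA \<and> z \<in> XA \<and> w \<noteq> z" for w z
        by (auto simp: lt_def split.cut_less_def)
      have min: "z \<in> XA \<Longrightarrow> z \<noteq> Minus x \<Longrightarrow> lt (Minus x) z" for z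
        using mp by (auto simp: lt_def split.cut_less_def)
      have max: "z \<in> XA \<Longrightarrow> z \<noteq> Plus x \<Longrightarrow> lt z (Plus x)" for z
        using mp by (auto simp: lt_def split.cut_less_def split_order_iff)
      have U_left: "z \<in> U" if "lt z u" for z
      proof -
        have "(u, z, Plus x) \<notin> RA"
          unfolding R_iff using that as max in_XA by metis
        then show ?thesis using u(3) in_XA that by metis
      qed
      have U_right: "z \<in> U" if "lt t z" for z
      proof -
        have "(Minus x, z, t) \<notin> RA"
          unfolding R_iff using that as min in_XA by metis
        then show ?thesis using t(3) in_XA that by metis
      qed
      have "\<not> XA \<subseteq> U" using whole ng by blast
      \<comment> \<open>If \<open>t\<close> preceded \<open>u\<close>, the two segments would cover
        \<open>XA\<close>.\<close>
      then have tu: "\<not> lt t u" using U_left U_right tr tot u(1) by blast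
      have "\<not> lt t (Minus x)" using min as in_XA by metis
      then have "(u, Minus x, t) \<notin> RA" unfolding R_iff using tu as min in_XA by metis
      then have xV: "x \<in> X - circ_closed_interval X R (split_proj u) (split_proj t)"
        using x u(1,2) t(1,2) mp(3) unfolding mem_arc_complement split_order_iff by auto
      have "z \<in> U" if z: "z \<in> XA"
        and zV: "split_proj z \<in> X - circ_closed_interval X R (split_proj u) (split_proj t)" for z
      proof (rule ccontr)
        assume "z \<notin> U"
        then have "\<not> lt z u" "\<not> lt t z" using U_left U_right by auto
        moreover have ne: "z \<noteq> u" "z \<noteq> t" "split_proj z \<noteq> split_proj u" "split_proj z \<noteq> split_proj t"
          using zV unfolding mem_arc_complement by auto
        ultimately have ut: "lt u z" "lt z t" using tot z u(1) t(1) by metis+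
        then have "(u, z, t) \<in> RA" using imp by metis
        \<comment> \<open>The triple cannot come from \<open>R\<close>, so it is a twin triple. But
          in the cut order \<open>Plus b\<close> precedes \<open>Minus b\<close> for
          \<open>b \<noteq> x\<close>, against \<open>lt u t\<close>.\<close>
        then obtain b where b: "u = Minus b" "t = Plus b"
          using zV[unfolded mem_arc_complement] ne unfolding split_order_iff by auto
        have "lt u t" using ut tr by metis
        then show False
          using b u(2) distinct3[of x b b] unfolding lt_def split.cut_less_def split_order_iff by auto
      qed
      moreover have "openin TX (X - circ_closed_interval X R (split_proj u) (split_proj t))"
        using u(1) t(1) by (intro openin_arc_complement split_proj_in)
      ultimately have goal unfolding goal_def using xV by blast
      then show False using ng by blast
    qed
  qed
  then show "\<exists>V. openin TX V \<and> x \<in> V \<and> {u \<in> XA. split_proj u \<in> V} \<subseteq> U"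
    unfolding goal_def .
qed

end

theorem lemma6p2:
  fixes X A :: "'a set" and R :: "('a \<times> 'a \<times> 'a) set"
  assumes "circular_order_on X R" and "A \<noteq> {}" and "A \<subseteq> X"
  defines "XA \<equiv> Split X A" and "RA \<equiv> split_order X R A"
    and "q \<equiv> (split_proj :: 'a split_point \<Rightarrow> 'a)"
  defines "TX \<equiv> circ_topology X R" and "TA \<equiv> circ_topology XA RA"
  shows
    "circular_order_on XA RA \<and> q ` XA = X \<and>
     \<comment> \<open>(i)\<close>
     (COP XA RA X R q \<and>
      (\<forall>a\<in>A. card {u \<in> XA. q u = a} = 2) \<and>
      (\<forall>x\<in>X - A. card {u \<in> XA. q u = x} = 1) \<and>
      LOTS TA) \<and>
     \<comment> \<open>(ii)\<close>
     (continuous_map TA TX q \<and> closed_map TA TX q \<and> quotient_map TA TX q \<and>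
      (\<forall>x\<in>X. finite {u \<in> XA. q u = x} \<and> card {u \<in> XA. q u = x} \<le> 2) \<and>
      perfect_map TA TX q) \<and>
     \<comment> \<open>(iii)\<close>
     ((compact_space TX \<longrightarrow> compact_space TA) \<and>
      (locally_compact_space TX \<longrightarrow> locally_compact_space TA)) \<and>
     \<comment> \<open>(iv)\<close>
     (separable_space TX \<and> countable A \<longrightarrow> separable_space TA) \<and>
     \<comment> \<open>(v)\<close>
     (second_countable TX \<and> countable A \<longrightarrow> second_countable TA) \<and>
     \<comment> \<open>(vi)\<close>
     (metrizable_space TX \<and> countable A \<longrightarrow> metrizable_space TA)"
proof -
  interpret split_circular_order X R A
    using assms by unfold_locales
  \<comment> \<open>The points over \<open>A\<close>, which form the two-point fibres, serve as the
    countable set \<open>N\<close> of the transfer lemmas.\<close>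
  have N: "countable (Minus ` A \<union> Plus ` A)" if "countable A" using that by simp
  have sub: "Minus ` A \<union> Plus ` A \<subseteq> topspace TA"
    by (auto simp: TA_def XA_def topspace_circ_topology Split_def)
  have inj: "u \<in> Minus ` A \<union> Plus ` A" if "u \<in> topspace TA" "v \<in> topspace TA" "q u = q v" "u \<noteq> v" for u v
    using that split_proj_eq[of u X A v] by (auto simp: TA_def XA_def q_def topspace_circ_topology)
  have onto: "q ` topspace TA = topspace TX"
    using split_proj_image by (simp add: TA_def TX_def XA_def q_def topspace_circ_topology)
  have lots: "LOTS TA" using LOTS_split assms(2) by (simp add: TA_def XA_def RA_def)
  note H = LOTS_imp_Hausdorff_space[OF lots]
  have cont: "continuous_map TA TX q" and clo: "closed_map TA TX q"
    using continuous_map_split_proj closed_map_split_proj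
    by (simp_all add: TA_def TX_def XA_def RA_def q_def)
  have fin: "finite {u \<in> topspace TA. q u = x}" for x
    using finite_fibre[of x] by (simp add: TA_def XA_def q_def topspace_circ_topology)
  have perf: "perfect_map TA TX q"
    unfolding perfect_map_def proper_map_def
    using cont clo onto fin by (auto intro: finite_imp_compactin)
  have two: "card {u \<in> XA. q u = a} = 2" if "a \<in> A" for a
    using fibre_in[OF that] by (simp add: XA_def q_def)
  have one: "card {u \<in> XA. q u = x} = 1" if "x \<in> X - A" for x
    using fibre_out[OF that] by (simp add: XA_def q_def)
  have "card {u \<in> XA. q u = x} \<le> 2" if "x \<in> X" for x
    using two[of x] one[of x] that by (cases "x \<in> A") auto
  moreover have "finite {u \<in> XA. q u = x}" for x
    using finite_fibre[of x] by (simp add: XA_def q_def)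
  moreover have "compact_space TA" if "compact_space TX"
    using compact_space_proper_map_preimage[OF _ onto that] perf by (simp add: perfect_map_def)
  moreover have "locally_compact_space TA" if "locally_compact_space TX"
    using locally_compact_space_perfect_map_preimage[OF that perf] .
  moreover have "separable_space TA" if "separable_space TX" "countable A"
    using separable_space_closed_map_preimage[OF that(1) clo onto N[OF that(2)] sub inj] .
  moreover have "second_countable TA" if "second_countable TX" "countable A"
    using second_countable_closed_map_preimage[OF that(1) H cont clo fin N[OF that(2)] sub inj] .
  moreover have "metrizable_space TA" if "metrizable_space TX" "countable A"
    using metrizable_space_closed_map_preimage[OF that(1) H cont clo fin N[OF that(2)] sub inj] .
  moreover have "quotient_map TA TX q"
    using continuous_closed_imp_quotient_map cont clo onto by blast
  ultimately show ?thesis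
    using cont clo perf lots two one circular_order_split COP_split_proj split_proj_image
    by (simp add: XA_def RA_def q_def)
qed

end
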